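(* Let $d\in\mathbb{N}_0$, let $\lambda_0,\lambda_1,\ldots,\lambda_d$ be distinct nonzero complex numbers, and let $c_0,c_1,\ldots,c_d$ be nonzero complex constants. For $k\in\mathbb{N}_0$ define $$W_k(r)=\sum_{j=0}^{d}c_j\lambda_j^k r^j,\qquad \mathcal{F}_k(z,s,a)=\sum_{r=0}^{\infty}\frac{W_k(r)z^r}{(r+a)^s},$$ where $a\in\mathbb{C}\setminus\{0,-1,-2,\ldots\}$ and $z,s\in\mathbb{C}$ are such that the series converges absolutely. For each $j=0,1,\ldots,d$ let the coefficients $\ell_{j,q}$ be defined by $$L_j(x)=\prod_{\substack{0\le m\le d\\ m\ne j}}\frac{x-\lambda_m}{\lambda_j-\lambda_m}=\sum_{q=0}^{d}\ell_{j,q}x^q.$$ Then, for every $j=0,1,\ldots,d$ and every $k\in\mathbb{N}_0$, $$D^j\Phi(z,s,a)=\frac{1}{c_j\lambda_j^k}\sum_{q=0}^{d}\ell_{j,q}\,\mathcal{F}_{k+q}(z,s,a).$$ Consequently, the $d+1$ consecutive functions $\mathcal{F}_k,\mathcal{F}_{k+1},\ldots,\mathcal{F}_{k+d}$ determine $\Phi,D\Phi,\ldots,D^d\Phi$.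
   Context: $\mathbb{N}_0=\{0,1,2,\ldots\}$, and $r^0=1$ for all $r\ge 0$. Complex powers are principal: $(r+a)^{-s}=\exp\{-s\operatorname{Log}(r+a)\}$, $-\pi<\operatorname{Arg}\le\pi$. The Hurwitz--Lerch transcendent is $\Phi(z,s,a)=\sum_{r=0}^{\infty}\frac{z^r}{(r+a)^s}$. $D=z\frac{d}{dz}$ is the Euler operator, $D^0\Phi=\Phi$; for $|z|<1$, $D^j\Phi(z,s,a)$ is the result of applying $D$ $j$ times to $\Phi$ in the variable $z$, and at points $|z|=1$ where the series converges absolutely, $D^j\Phi(z,s,a)$ means the termwise-differentiated series $\sum_{r\ge0}r^jz^r/(r+a)^s$. *)

theory Defs
  imports "HOL-Analysis.Analysis" "HOL-Computational_Algebra.Polynomial"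
begin

text \<open>
  For complex arguments \<open>w powr s = exp (s * Ln w)\<close> (\<open>w \<noteq> 0\<close>) with the principal logarithm
  \<open>- pi < Im (Ln w) \<le> pi\<close>, so \<open>1 / w powr s\<close> is the principal value of the power \<open>-s\<close>
  of \<open>w\<close>.
\<close>

definition lerch_phi :: "complex \<Rightarrow> complex \<Rightarrow> complex \<Rightarrow> complex" where
  "lerch_phi z s a = (\<Sum>r. z ^ r / (of_nat r + a) powr s)"

definition euler_op :: "(complex \<Rightarrow> complex) \<Rightarrow> complex \<Rightarrow> complex" where
  "euler_op f = (\<lambda>z. z * deriv f z)"

definition lerch_D_term :: "nat \<Rightarrow> complex \<Rightarrow> complex \<Rightarrow> complex \<Rightarrow> nat \<Rightarrow> complex" where
  "lerch_D_term j z s a r = of_nat r ^ j * z ^ r / (of_nat r + a) powr s"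

text \<open>
  Inside the unit disc the Euler operator is really iterated; the termwise series is the
  convention for boundary points \<open>norm z = 1\<close> where it converges absolutely, and the value
  of the second branch is meaningful only there.
\<close>

definition lerch_D :: "nat \<Rightarrow> complex \<Rightarrow> complex \<Rightarrow> complex \<Rightarrow> complex" where
  "lerch_D j z s a =
     (if norm z < 1 then (euler_op ^^ j) (\<lambda>w. lerch_phi w s a) z
      else (\<Sum>r. lerch_D_term j z s a r))"

definition W :: "nat \<Rightarrow> (nat \<Rightarrow> complex) \<Rightarrow> (nat \<Rightarrow> complex) \<Rightarrow> nat \<Rightarrow> nat \<Rightarrow> complex" where
  "W d c lam k r = (\<Sum>j\<le>d. c j * lam j ^ k * of_nat r ^ j)"

definition F_term :: "nat \<Rightarrow> (nat \<Rightarrow> complex) \<Rightarrow> (nat \<Rightarrow> complex) \<Rightarrow> nat \<Rightarrow>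
    complex \<Rightarrow> complex \<Rightarrow> complex \<Rightarrow> nat \<Rightarrow> complex" where
  "F_term d c lam k z s a r = W d c lam k r * z ^ r / (of_nat r + a) powr s"

definition F :: "nat \<Rightarrow> (nat \<Rightarrow> complex) \<Rightarrow> (nat \<Rightarrow> complex) \<Rightarrow> nat \<Rightarrow>
    complex \<Rightarrow> complex \<Rightarrow> complex \<Rightarrow> complex" where
  "F d c lam k z s a = (\<Sum>r. F_term d c lam k z s a r)"

definition F_domain :: "nat \<Rightarrow> (nat \<Rightarrow> complex) \<Rightarrow> (nat \<Rightarrow> complex) \<Rightarrow>
    (complex \<times> complex \<times> complex) set" where
  "F_domain d c lam =
     {(z, s, a). a \<notin> \<int>\<^sub>\<le>\<^sub>0 \<and> (\<forall>k. summable (\<lambda>r. norm (F_term d c lam k z s a r)))}"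

definition lagrange_basis :: "nat \<Rightarrow> (nat \<Rightarrow> complex) \<Rightarrow> nat \<Rightarrow> complex poly" where
  "lagrange_basis d lam j =
     (\<Prod>m\<in>{..d} - {j}. smult (1 / (lam j - lam m)) [:- lam m, 1:])"

definition lagrange_coeff :: "nat \<Rightarrow> (nat \<Rightarrow> complex) \<Rightarrow> nat \<Rightarrow> nat \<Rightarrow> complex" where
  "lagrange_coeff d lam j q = coeff (lagrange_basis d lam j) q"

end

theory Submission
  imports Defs "HOL-Real_Asymp.Real_Asymp"
begin

text \<open>
  Term by term, \<open>W\<^sub>k(r)\<close> is a linear combination of \<open>1, r, \<dots>, r^d\<close> whose \<open>j\<close>-th coefficient
  \<open>c\<^sub>j \<lambda>\<^sub>j^k\<close> is geometric in \<open>k\<close>. A combination \<open>\<Sum>q. p\<^sub>q W\<^bsub>k+q\<^esub>(r)\<close> multiplies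
  that coefficient by the value \<open>p(\<lambda>\<^sub>j)\<close> of the polynomial \<open>p\<close> with coefficients \<open>p\<^sub>q\<close>; taking
  for \<open>p\<close> the Lagrange polynomial \<open>L\<^sub>j\<close>, which is 1 at \<open>\<lambda>\<^sub>j\<close> and 0 at the other nodes, isolates
  \<open>c\<^sub>j \<lambda>\<^sub>j^k r^j\<close> (lemma \<open>lagrange_combination_of_W\<close>). Since this combination is finite, absolute
  convergence of the series for the functions \<open>F\<close> gives absolute convergence of
  \<open>\<Sum>r. r^j z^r / (r + a)^s\<close>, and the identity passes to the sums.

  On the unit circle this termwise series is \<open>D^j \<Phi>\<close> by convention. Inside the disc
  the operator \<open>D\<close> is applied to a function, and differentiating under the sum needs
  convergence in a neighbourhood of \<open>z\<close>, which convergence at \<open>z\<close> alone does not give.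
  It comes from the polynomial growth of \<open>(r + a)^(-s)\<close>, by which the series for \<open>\<Phi>\<close> converges in
  the whole open disc (lemma \<open>summable_lerch\<close>). There \<open>D\<close> multiplies the \<open>r\<close>-th coefficient of a
  power series by \<open>r\<close>, and induction gives \<open>D^j \<Phi>\<close>.

  The formula for \<open>D^j \<Phi>\<close> involves the point \<open>(z, s, a)\<close> only through the values of
  \<open>F\<^sub>k, \<dots>, F\<^bsub>k+d\<^esub>\<close>, whence the statement on determination.
\<close>

section \<open>Isolating one power by Lagrange interpolation\<close>

lemma degree_lagrange_basis_le:
  assumes "j \<le> d"
  shows "degree (lagrange_basis d lam j) \<le> d"
proof -
  have "degree (lagrange_basis d lam j)
          \<le> (\<Sum>m\<in>{..d} - {j}. degree (smult (1 / (lam j - lam m)) [:- lam m, 1:]))"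
    unfolding lagrange_basis_def by (rule degree_prod_sum_le[unfolded o_def]) simp
  also have "\<dots> \<le> (\<Sum>m\<in>{..d} - {j}. 1)"
    by (intro sum_mono) (simp add: degree_smult_eq)
  also have "\<dots> = d"
    using assms by (simp add: card_Diff_singleton)
  finally show ?thesis .
qed

lemma poly_lagrange_basis_node:
  assumes "inj_on lam {..d}" "i \<le> d" "j \<le> d"
  shows "poly (lagrange_basis d lam j) (lam i) = (if i = j then 1 else 0)"
proof -
  have "poly (lagrange_basis d lam j) (lam i)
          = (\<Prod>m\<in>{..d} - {j}. (lam i - lam m) / (lam j - lam m))"
    by (simp add: lagrange_basis_def poly_prod diff_divide_distrib)
  also have "\<dots> = (if i = j then 1 else 0)"
  proof (cases "i = j")
    case True
    have "(lam j - lam m) / (lam j - lam m) = 1" if "m \<in> {..d} - {j}" for m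
      using that assms by (auto dest: inj_onD)
    then show ?thesis using True by simp
  next
    case False
    then show ?thesis using assms by (auto intro!: bexI[of _ i])
  qed
  finally show ?thesis .
qed

lemma sum_lagrange_coeff_node:
  assumes "inj_on lam {..d}" "i \<le> d" "j \<le> d"
  shows "(\<Sum>q\<le>d. lagrange_coeff d lam j q * lam i ^ q) = (if i = j then 1 else 0)"
proof -
  let ?p = "lagrange_basis d lam j"
  have "(\<Sum>q\<le>d. coeff ?p q * lam i ^ q) = (\<Sum>q\<le>degree ?p. coeff ?p q * lam i ^ q)"
    using degree_lagrange_basis_le[OF assms(3), of lam]
    by (intro sum.mono_neutral_right) (auto simp: coeff_eq_0)
  then show ?thesis
    using poly_lagrange_basis_node[OF assms] by (simp add: lagrange_coeff_def poly_altdef)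
qed

lemma lagrange_combination_of_W:
  assumes "inj_on lam {..d}" "j \<le> d"
  shows "(\<Sum>q\<le>d. lagrange_coeff d lam j q * W d c lam (k + q) r) = c j * lam j ^ k * of_nat r ^ j"
proof -
  have "(\<Sum>q\<le>d. lagrange_coeff d lam j q * W d c lam (k + q) r)
      = (\<Sum>q\<le>d. \<Sum>i\<le>d. c i * lam i ^ k * of_nat r ^ i * (lagrange_coeff d lam j q * lam i ^ q))"
    by (simp add: W_def sum_distrib_left power_add mult_ac)
  also have "\<dots> = (\<Sum>i\<le>d. c i * lam i ^ k * of_nat r ^ i *
                       (\<Sum>q\<le>d. lagrange_coeff d lam j q * lam i ^ q))"
    by (subst sum.swap) (simp add: sum_distrib_left)
  also have "\<dots> = (\<Sum>i\<le>d. if i = j then c i * lam i ^ k * of_nat r ^ i else 0)"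
    by (intro sum.cong) (use assms in \<open>auto simp: sum_lagrange_coeff_node\<close>)
  also have "\<dots> = c j * lam j ^ k * of_nat r ^ j"
    using assms by simp
  finally show ?thesis .
qed

lemma lerch_D_term_eq:
  assumes "inj_on lam {..d}" "j \<le> d" "lam j \<noteq> 0" "c j \<noteq> 0"
  shows "lerch_D_term j z s a r = 1 / (c j * lam j ^ k) *
           (\<Sum>q\<le>d. lagrange_coeff d lam j q * F_term d c lam (k + q) z s a r)"
proof -
  have "(\<Sum>q\<le>d. lagrange_coeff d lam j q * F_term d c lam (k + q) z s a r)
      = (\<Sum>q\<le>d. lagrange_coeff d lam j q * W d c lam (k + q) r) * (z ^ r / (of_nat r + a) powr s)"
    by (simp add: F_term_def sum_distrib_right sum_divide_distrib mult.assoc)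
  also have "\<dots> = c j * lam j ^ k * lerch_D_term j z s a r"
    by (simp add: lagrange_combination_of_W[OF assms(1,2)] lerch_D_term_def)
  finally show ?thesis using assms by simp
qed

lemma summable_norm_lerch_D_term:
  assumes "inj_on lam {..d}" "j \<le> d" "lam j \<noteq> 0" "c j \<noteq> 0"
    and "\<And>k. summable (\<lambda>r. norm (F_term d c lam k z s a r))"
  shows "summable (\<lambda>r. norm (lerch_D_term j z s a r))"
proof (rule summable_comparison_test')
  let ?C = "norm (1 / c j)"
  show "summable (\<lambda>r. ?C *
          (\<Sum>q\<le>d. norm (lagrange_coeff d lam j q) * norm (F_term d c lam q z s a r)))"
    by (intro summable_mult summable_sum assms(5))
  fix r :: nat
  have "norm (lerch_D_term j z s a r)
      = ?C * norm (\<Sum>q\<le>d. lagrange_coeff d lam j q * F_term d c lam q z s a r)"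
    using lerch_D_term_eq[where k = 0, of lam d j c z s a r] assms(1-4)
    by (simp add: norm_mult norm_divide)
  also have "\<dots> \<le> ?C *
      (\<Sum>q\<le>d. norm (lagrange_coeff d lam j q) * norm (F_term d c lam q z s a r))"
    by (intro mult_left_mono order_trans[OF norm_sum]) (auto simp: norm_mult)
  finally show "norm (norm (lerch_D_term j z s a r)) \<le> \<dots>" by simp
qed

lemma suminf_lerch_D_term_eq:
  assumes "inj_on lam {..d}" "j \<le> d" "lam j \<noteq> 0" "c j \<noteq> 0"
    and "\<And>k. summable (\<lambda>r. norm (F_term d c lam k z s a r))"
  shows "(\<Sum>r. lerch_D_term j z s a r) =
           1 / (c j * lam j ^ k) * (\<Sum>q\<le>d. lagrange_coeff d lam j q * F d c lam (k + q) z s a)"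
proof -
  have "(\<lambda>r. 1 / (c j * lam j ^ k) *
           (\<Sum>q\<le>d. lagrange_coeff d lam j q * F_term d c lam (k + q) z s a r))
        sums (1 / (c j * lam j ^ k) *
           (\<Sum>q\<le>d. lagrange_coeff d lam j q * F d c lam (k + q) z s a))"
    unfolding F_def
    by (intro sums_mult sums_sum summable_sums summable_norm_cancel[OF assms(5)])
  moreover have "lerch_D_term j z s a = (\<lambda>r. 1 / (c j * lam j ^ k) *
           (\<Sum>q\<le>d. lagrange_coeff d lam j q * F_term d c lam (k + q) z s a r))"
    using assms(1-4) by (intro ext lerch_D_term_eq)
  ultimately show ?thesis by (simp only: sums_iff)
qed

section \<open>The Euler operator on the Lerch series\<close>

text \<open>
  The modulus of \<open>(r + a)^(-s)\<close> is at most \<open>exp (\<bar>s\<bar> \<bar>Ln (r + a)\<bar>)\<close>, and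
  \<open>\<bar>Ln (r + a)\<bar>\<close> is at most \<open>ln (r + \<bar>a\<bar>) + \<pi>\<close> once \<open>r + a\<close> has left the unit disc; so the
  coefficients grow at most like \<open>r^\<bar>s\<bar>\<close> and the radius of convergence is at least 1.
\<close>

lemma summable_lerch:
  fixes w s a :: complex
  assumes "norm w < 1"
  shows "summable (\<lambda>r. 1 / (of_nat r + a) powr s * w ^ r)"
proof -
  \<comment> \<open>Passing from \<open>\<bar>w\<bar>\<close> to a larger \<open>x\<close> keeps the base of the majorant positive when \<open>w = 0\<close>.\<close>
  obtain x where x: "norm w < x" "x < 1" using assms dense by blast
  then have x0: "x > 0" using norm_ge_zero[of w] by linarith
  define S A where "S = norm s" and "A = norm a"
  have nonneg: "S \<ge> 0" "A \<ge> 0" by (simp_all add: S_def A_def)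
  let ?g = "\<lambda>r::nat. exp (S * (ln (real r + A) + pi)) * x ^ r"
  have "?g \<in> O(\<lambda>r. 1 / real r ^ 2)"
    using x x0 nonneg by real_asymp
  moreover have "summable (\<lambda>r. norm (1 / real r ^ 2))"
    using inverse_power_summable[of 2, where ?'a = real] by (simp add: field_simps)
  ultimately have majorant: "summable ?g"
    by (rule summable_comparison_test_bigo[rotated])
  have "\<forall>\<^sub>F r in sequentially. norm (1 / (of_nat r + a) powr s * w ^ r) \<le> ?g r"
    using eventually_ge_at_top[of "nat \<lceil>A + 1\<rceil>"]
  proof eventually_elim
    case (elim r)
    define v where "v = of_nat r + a"
    have r: "real r \<ge> A + 1" using elim by linarith
    have v1: "norm v \<ge> 1"
      using norm_diff_ineq[of "of_nat r" a] r by (simp add: v_def A_def)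
    have v2: "norm v \<le> real r + A"
      using norm_triangle_ineq[of "of_nat r" a] by (simp add: v_def A_def)
    have v0: "v \<noteq> 0" using v1 by auto
    have "norm (Ln v) \<le> \<bar>Re (Ln v)\<bar> + \<bar>Im (Ln v)\<bar>" by (rule cmod_le)
    also have "\<bar>Im (Ln v)\<bar> \<le> pi"
      using Im_Ln_le_pi[OF v0] mpi_less_Im_Ln[OF v0] by linarith
    also have "\<bar>Re (Ln v)\<bar> \<le> ln (real r + A)"
      using v0 v1 v2 by simp
    finally have "norm (Ln v) \<le> ln (real r + A) + pi" by simp
    then have "norm (s * Ln v) \<le> S * (ln (real r + A) + pi)"
      unfolding norm_mult S_def by (intro mult_left_mono) auto
    then have "- Re (s * Ln v) \<le> S * (ln (real r + A) + pi)"
      using abs_Re_le_cmod[of "s * Ln v"] by linarith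
    then have "norm (1 / v powr s) \<le> exp (S * (ln (real r + A) + pi))"
      using v0 by (simp add: powr_def norm_divide exp_minus[symmetric] divide_inverse)
    moreover have "norm w ^ r \<le> x ^ r"
      using x by (intro power_mono) auto
    ultimately show ?case
      unfolding norm_mult norm_power v_def[symmetric] by (intro mult_mono) auto
  qed
  then show ?thesis using majorant by (rule summable_comparison_test_ev)
qed

lemma summable_times_index:
  fixes b :: "nat \<Rightarrow> complex"
  assumes "\<And>w. norm w < 1 \<Longrightarrow> summable (\<lambda>r. b r * w ^ r)" and "norm z < 1"
  shows "(\<lambda>r. of_nat r * b r * z ^ r) sums (z * (\<Sum>r. diffs b r * z ^ r))"
proof -
  have "summable (\<lambda>r. diffs b r * z ^ r)"
    using assms by (intro termdiff_converges[of z 1 b])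
  then have "(\<lambda>r. z * (of_nat r * b r * z ^ (r - Suc 0))) sums (z * (\<Sum>r. diffs b r * z ^ r))"
    by (intro sums_mult diffs_equiv)
  moreover have "z * (of_nat r * b r * z ^ (r - Suc 0)) = of_nat r * b r * z ^ r" for r
    by (cases r) auto
  ultimately show ?thesis by simp
qed

lemma euler_op_power_series:
  fixes b :: "nat \<Rightarrow> complex"
  assumes "\<And>w. norm w < 1 \<Longrightarrow> summable (\<lambda>r. b r * w ^ r)" and "norm z < 1"
  shows "euler_op (\<lambda>w. \<Sum>r. b r * w ^ r) z = (\<Sum>r. of_nat r * b r * z ^ r)"
proof -
  have "((\<lambda>w. \<Sum>r. b r * w ^ r) has_field_derivative (\<Sum>r. diffs b r * z ^ r)) (at z)"
    using assms by (intro termdiffs_strong'[of 1 b z])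
  then have "deriv (\<lambda>w. \<Sum>r. b r * w ^ r) z = (\<Sum>r. diffs b r * z ^ r)"
    by (rule DERIV_imp_deriv)
  then show ?thesis
    using summable_times_index[OF assms] by (simp add: euler_op_def sums_iff)
qed

text \<open>
  A derivative depends only on the function near the point, so in iterating \<open>D\<close> it is enough to
  know the previous iterate in the open unit disc.
\<close>

lemma euler_op_cong_disc:
  assumes "\<And>w. norm w < 1 \<Longrightarrow> f w = g w" and "norm z < 1"
  shows "euler_op f z = euler_op g z"
proof -
  have "\<forall>\<^sub>F w in nhds z. w \<in> ball 0 1"
    using assms(2) by (intro eventually_nhds_in_open) auto
  then have "\<forall>\<^sub>F w in nhds z. f w = g w"
    by eventually_elim (auto intro: assms(1))
  then show ?thesis unfolding euler_op_def by (simp cong: deriv_cong_ev)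
qed

lemma euler_op_funpow_power_series:
  fixes b :: "nat \<Rightarrow> complex"
  assumes "\<And>w. norm w < 1 \<Longrightarrow> summable (\<lambda>r. b r * w ^ r)" and "norm z < 1"
  shows "summable (\<lambda>r. of_nat r ^ j * b r * z ^ r) \<and>
         (euler_op ^^ j) (\<lambda>w. \<Sum>r. b r * w ^ r) z = (\<Sum>r. of_nat r ^ j * b r * z ^ r)"
  using assms(2)
proof (induction j arbitrary: z)
  case 0
  then show ?case using assms(1) by simp
next
  case (Suc j)
  let ?b = "\<lambda>r. of_nat r ^ j * b r"
  have sb: "summable (\<lambda>r. ?b r * w ^ r)" if "norm w < 1" for w
    using Suc.IH[OF that] by simp
  have "(euler_op ^^ Suc j) (\<lambda>w. \<Sum>r. b r * w ^ r) z = euler_op (\<lambda>w. \<Sum>r. ?b r * w ^ r) z"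
    using Suc.IH Suc.prems by (auto intro: euler_op_cong_disc)
  also have "\<dots> = (\<Sum>r. of_nat r * ?b r * z ^ r)"
    using sb Suc.prems by (rule euler_op_power_series)
  finally show ?case
    using sums_summable[OF summable_times_index[OF sb Suc.prems]] by (simp add: mult_ac)
qed

lemma lerch_D_eq_suminf: "lerch_D j z s a = (\<Sum>r. lerch_D_term j z s a r)"
proof (cases "norm z < 1")
  case True
  let ?b = "\<lambda>r. 1 / (of_nat r + a) powr s"
  have "(\<lambda>w. lerch_phi w s a) = (\<lambda>w. \<Sum>r. ?b r * w ^ r)"
    by (simp add: lerch_phi_def)
  moreover have "lerch_D_term j z s a = (\<lambda>r. of_nat r ^ j * ?b r * z ^ r)"
    by (simp add: lerch_D_term_def fun_eq_iff)
  ultimately show ?thesis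
    using euler_op_funpow_power_series[OF summable_lerch True] True by (simp add: lerch_D_def)
qed (simp add: lerch_D_def)

section \<open>Recovering the Euler derivatives\<close>

theorem theorem5p2:
  fixes d :: nat and c lam :: "nat \<Rightarrow> complex"
  assumes "inj_on lam {..d}"
    and "\<And>j. j \<le> d \<Longrightarrow> lam j \<noteq> 0"
    and "\<And>j. j \<le> d \<Longrightarrow> c j \<noteq> 0"
  shows "(\<forall>z s a. (z, s, a) \<in> F_domain d c lam \<longrightarrow>
            (\<forall>j\<le>d. summable (\<lambda>r. norm (lerch_D_term j z s a r)) \<and>
              (\<forall>k. lerch_D j z s a =
                1 / (c j * lam j ^ k) *
                  (\<Sum>q\<le>d. lagrange_coeff d lam j q * F d c lam (k + q) z s a)))) \<and>
         (\<forall>k z s a z' s' a'.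
            (z, s, a) \<in> F_domain d c lam \<longrightarrow> (z', s', a') \<in> F_domain d c lam \<longrightarrow>
            (\<forall>q\<le>d. F d c lam (k + q) z s a = F d c lam (k + q) z' s' a') \<longrightarrow>
            (\<forall>j\<le>d. lerch_D j z s a = lerch_D j z' s' a'))"
proof -
  have summ: "summable (\<lambda>r. norm (lerch_D_term j z s a r))"
    if "(z, s, a) \<in> F_domain d c lam" "j \<le> d" for z s a j
    using that
    by (intro summable_norm_lerch_D_term[where c = c and lam = lam and d = d] assms)
       (simp_all add: F_domain_def)
  have formula: "lerch_D j z s a = 1 / (c j * lam j ^ k) *
        (\<Sum>q\<le>d. lagrange_coeff d lam j q * F d c lam (k + q) z s a)"
    if "(z, s, a) \<in> F_domain d c lam" "j \<le> d" for z s a j k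
    unfolding lerch_D_eq_suminf
    using that by (intro suminf_lerch_D_term_eq assms) (simp_all add: F_domain_def)
  have determined: "lerch_D j z s a = lerch_D j z' s' a'"
    if "(z, s, a) \<in> F_domain d c lam" "(z', s', a') \<in> F_domain d c lam" "j \<le> d"
      and "\<forall>q\<le>d. F d c lam (k + q) z s a = F d c lam (k + q) z' s' a'"
    for k z s a z' s' a' j
    unfolding formula[OF that(1,3), of k] formula[OF that(2,3), of k]
    using that(4) by simp
  show ?thesis
    by (intro conjI allI impI) (rule summ formula determined; assumption)+
qed

end
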